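(* Let $\nu>0$, let $\chi_\omega\in L^\infty(\mathbb{T}^3)$ be nonnegative, let $t\mapsto K(\rho(t))$ be a bounded measurable nonnegative function on $[0,\infty)$, let $K_{\min}\ge 0$, and let $u_0\in H$. Define $$\alpha_\omega(K_{\min}):=\inf_{v\in V\setminus\{0\}}\frac{\nu\|\nabla v\|_{L^2}^2+K_{\min}\|\chi_\omega^{1/2}v\|_{L^2}^2}{\|v\|_{L^2}^2}.$$ Assume that $\alpha_\omega(K_{\min})>0$ and that $K(\rho(t))\ge K_{\min}$ for almost every $t\ge 0$. Then any Leray--Hopf weak solution $u$ of $$\partial_t u+(u\cdot\nabla)u-\nu\Delta u+\nabla p=-\chi_\omega(x)K(\rho(t))u,\qquad \nabla\cdot u=0,\qquad u(\cdot,0)=u_0$$ on $\mathbb{T}^3\times[0,\infty)$ satisfies $$\|u(t)\|_{L^2}\le e^{-\alpha_\omega(K_{\min})t}\|u_0\|_{L^2},\qquad\forall t\ge 0.$$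
   Context: $\mathbb{T}^3=(\mathbb{R}/\mathbb{Z})^3$. $H:=\{v\in L^2(\mathbb{T}^3;\mathbb{R}^3): \nabla\cdot v=0,\ \int_{\mathbb{T}^3}v\,dx=0\}$ with the $L^2$ norm, and $V:=H^1(\mathbb{T}^3;\mathbb{R}^3)\cap H$. The function $\chi_\omega$ is typically the indicator function of a measurable set $\omega\subset\mathbb{T}^3$ or a smooth cutoff supported in $\omega$. The equation is understood in the space $H$ (i.e. after applying the orthogonal projector onto divergence-free, zero-mean fields). A Leray--Hopf weak solution is a function $u\in L^\infty(0,\infty;H)\cap L^2_{\mathrm{loc}}([0,\infty);V)$, weakly continuous from $[0,\infty)$ into $H$, with $u(0)=u_0$, which satisfies the equation in the weak sense tested against smooth divergence-free zero-mean test fields, and which satisfies the energy inequality: for $s=0$ and for almost every $s\ge 0$, and for every $t\ge s$, $$\tfrac12\|u(t)\|_{L^2}^2+\nu\int_s^t\|\nabla u(\tau)\|_{L^2}^2\,d\tau+\int_s^tK(\rho(\tau))\,\|\chi_\omega^{1/2}u(\tau)\|_{L^2}^2\,d\tau\le\tfrac12\|u(s)\|_{L^2}^2.$$ *)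

theory Defs
  imports "HOL-Analysis.Analysis"
begin

section \<open>Functions on the torus\<close>

text \<open>
  Functions on the torus (R/Z)^3 are represented by Z^3-periodic functions on \<^typ>\<open>real^3\<close>,
  integrated over the unit cell. Elements of Lebesgue and Sobolev spaces are represented by
  functions, with equality of elements being equality almost everywhere.
\<close>

abbreviation torus :: "(real^3) measure" where
  "torus \<equiv> lebesgue_on (cbox 0 1)"

definition periodic :: "(real^3 \<Rightarrow> 'b) \<Rightarrow> bool" where
  "periodic f \<longleftrightarrow> (\<forall>x k. (\<forall>i. k $ i \<in> \<int>) \<longrightarrow> f (x + k) = f x)"

definition Linf_torus :: "(real^3 \<Rightarrow> real) set" where
  "Linf_torus = {f. periodic f \<and> f \<in> borel_measurable torus \<and> (\<exists>C. AE x in torus. \<bar>f x\<bar> \<le> C)}"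

definition L2_torus :: "(real^3 \<Rightarrow> 'b::euclidean_space) set" where
  "L2_torus = {f. periodic f \<and> f \<in> borel_measurable torus \<and> integrable torus (\<lambda>x. (norm (f x))\<^sup>2)}"

text \<open>For matrix-valued functions the pointwise norm is the Frobenius norm.\<close>

definition L2_norm :: "(real^3 \<Rightarrow> 'b::euclidean_space) \<Rightarrow> real" where
  "L2_norm f = sqrt (LINT x|torus. (norm (f x))\<^sup>2)"

definition L2_inner :: "(real^3 \<Rightarrow> 'b::euclidean_space) \<Rightarrow> (real^3 \<Rightarrow> 'b) \<Rightarrow> real" where
  "L2_inner f g = (LINT x|torus. f x \<bullet> g x)"

primrec C_class :: "nat \<Rightarrow> ('a::euclidean_space \<Rightarrow> 'b::real_normed_vector) \<Rightarrow> bool" where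
  "C_class 0 f = continuous_on UNIV f"
| "C_class (Suc k) f =
     ((\<forall>x. f differentiable (at x)) \<and> (\<forall>e\<in>Basis. C_class k (\<lambda>x. frechet_derivative f (at x) e)))"

definition smooth :: "('a::euclidean_space \<Rightarrow> 'b::real_normed_vector) \<Rightarrow> bool" where
  "smooth f \<longleftrightarrow> (\<forall>k. C_class k f)"

definition partial_deriv :: "3 \<Rightarrow> (real^3 \<Rightarrow> real) \<Rightarrow> real^3 \<Rightarrow> real" where
  "partial_deriv j f x = frechet_derivative f (at x) (axis j 1)"


section \<open>The spaces H and V\<close>

text \<open>The divergence of an \<open>L\<^sup>2\<close> field and the gradient of an \<open>H\<^sup>1\<close> field are distributional.\<close>

definition weakly_div_free :: "(real^3 \<Rightarrow> real^3) \<Rightarrow> bool" where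
  "weakly_div_free v \<longleftrightarrow>
     (\<forall>\<phi>. smooth \<phi> \<and> periodic \<phi> \<longrightarrow> (LINT x|torus. v x \<bullet> (\<chi> j. partial_deriv j \<phi> x)) = 0)"

definition H_space :: "(real^3 \<Rightarrow> real^3) set" where
  "H_space = {v \<in> L2_torus. weakly_div_free v \<and> (LINT x|torus. v x) = 0}"

text \<open>Row i, column j of the gradient is the j-th partial derivative of the i-th component,
  as for \<^const>\<open>jacobian\<close>.\<close>

definition has_weak_grad :: "(real^3 \<Rightarrow> real^3) \<Rightarrow> (real^3 \<Rightarrow> real^3^3) \<Rightarrow> bool" where
  "has_weak_grad v G \<longleftrightarrow>
     (\<forall>\<phi> i j. smooth \<phi> \<and> periodic \<phi> \<longrightarrow>
        (LINT x|torus. v x $ i * partial_deriv j \<phi> x) = - (LINT x|torus. G x $ i $ j * \<phi> x))"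

definition H1_torus :: "(real^3 \<Rightarrow> real^3) set" where
  "H1_torus = {v \<in> L2_torus. \<exists>G\<in>L2_torus. has_weak_grad v G}"

text \<open>The weak gradient of an \<open>H\<^sup>1\<close> field is unique up to null sets. Outside \<open>H\<^sup>1\<close> the value
  is unspecified.\<close>

definition weak_grad :: "(real^3 \<Rightarrow> real^3) \<Rightarrow> real^3 \<Rightarrow> real^3^3" where
  "weak_grad v = (SOME G. G \<in> L2_torus \<and> has_weak_grad v G)"

definition V_space :: "(real^3 \<Rightarrow> real^3) set" where
  "V_space = H1_torus \<inter> H_space"

definition V_norm :: "(real^3 \<Rightarrow> real^3) \<Rightarrow> real" where
  "V_norm v = sqrt ((L2_norm v)\<^sup>2 + (L2_norm (weak_grad v))\<^sup>2)"


section \<open>Time-dependent fields\<close>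

text \<open>Bochner (strong) measurability: almost everywhere limit, in the norm \<open>N\<close> of the space \<open>X\<close>,
  of \<open>X\<close>-valued simple functions.\<close>

definition strongly_measurable ::
  "real measure \<Rightarrow> (real^3 \<Rightarrow> real^3) set \<Rightarrow> ((real^3 \<Rightarrow> real^3) \<Rightarrow> real) \<Rightarrow>
   (real \<Rightarrow> real^3 \<Rightarrow> real^3) \<Rightarrow> bool" where
  "strongly_measurable M X N u \<longleftrightarrow>
     (\<exists>s. (\<forall>n. simple_function M (s n) \<and> s n ` space M \<subseteq> X) \<and>
          (AE t in M. (\<lambda>n. N (\<lambda>x. s n t x - u t x)) \<longlonglongrightarrow> 0))"

definition Linf_H :: "(real \<Rightarrow> real^3 \<Rightarrow> real^3) \<Rightarrow> bool" where
  "Linf_H u \<longleftrightarrow>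
     (AE t in lebesgue_on {0<..}. u t \<in> H_space) \<and>
     strongly_measurable (lebesgue_on {0<..}) H_space L2_norm u \<and>
     (\<exists>C. AE t in lebesgue_on {0<..}. L2_norm (u t) \<le> C)"

definition L2loc_V :: "(real \<Rightarrow> real^3 \<Rightarrow> real^3) \<Rightarrow> bool" where
  "L2loc_V u \<longleftrightarrow>
     (\<forall>T>0. (AE t in lebesgue_on {0..T}. u t \<in> V_space) \<and>
        strongly_measurable (lebesgue_on {0..T}) V_space V_norm u \<and>
        integrable (lebesgue_on {0..T}) (\<lambda>t. (V_norm (u t))\<^sup>2))"

definition weakly_continuous_H :: "(real \<Rightarrow> real^3 \<Rightarrow> real^3) \<Rightarrow> bool" where
  "weakly_continuous_H u \<longleftrightarrow>
     (\<forall>t\<ge>0. u t \<in> H_space) \<and> (\<forall>w\<in>H_space. continuous_on {0..} (\<lambda>t. L2_inner (u t) w))"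


section \<open>Leray--Hopf weak solutions\<close>

text \<open>Divergence-free, zero-mean test fields, smooth up to and including time 0 and vanishing
  for large times. They need not vanish at time 0, so that the weak form sees the initial datum.\<close>

definition test_field :: "(real \<Rightarrow> real^3 \<Rightarrow> real^3) \<Rightarrow> bool" where
  "test_field \<phi> \<longleftrightarrow>
     smooth (\<lambda>(t, x). \<phi> t x) \<and>
     (\<forall>t. periodic (\<phi> t) \<and> (\<forall>x. trace (jacobian (\<phi> t) (at x)) = 0) \<and> (LINT x|torus. \<phi> t x) = 0) \<and>
     (\<exists>T. \<forall>t\<ge>T. \<forall>x. \<phi> t x = 0)"

text \<open>
  Weak form of \<open>\<partial>\<^sub>t u + (u \<cdot> \<nabla>) u - \<nu> \<Delta> u + \<nabla> p = - \<chi>\<^sub>\<omega> \<kappa>(t) u\<close>, \<open>u(0) = u\<^sub>0\<close>: the equation is multiplied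
  by the test field and integrated by parts in time and space. The convection term becomes
  \<open>- u \<cdot> (u \<cdot> \<nabla>) \<phi>\<close> since u is divergence free, and the pressure term vanishes since the test
  field is.
\<close>

definition weak_form ::
  "real \<Rightarrow> (real^3 \<Rightarrow> real) \<Rightarrow> (real \<Rightarrow> real) \<Rightarrow> (real^3 \<Rightarrow> real^3) \<Rightarrow>
   (real \<Rightarrow> real^3 \<Rightarrow> real^3) \<Rightarrow> bool" where
  "weak_form \<nu> \<chi>\<omega> \<kappa> u0 u \<longleftrightarrow>
     (\<forall>\<phi>. test_field \<phi> \<longrightarrow>
        (LINT t|lebesgue_on {0..}. LINT x|torus.
             - (u t x \<bullet> vector_derivative (\<lambda>s. \<phi> s x) (at t))
             - u t x \<bullet> (jacobian (\<phi> t) (at x) *v u t x)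
             + \<nu> * (weak_grad (u t) x \<bullet> jacobian (\<phi> t) (at x))
             + \<chi>\<omega> x * \<kappa> t * (u t x \<bullet> \<phi> t x))
        = (LINT x|torus. u0 x \<bullet> \<phi> 0 x))"

definition damping_norm :: "(real^3 \<Rightarrow> real) \<Rightarrow> (real^3 \<Rightarrow> real^3) \<Rightarrow> real" where
  "damping_norm \<chi>\<omega> v = L2_norm (\<lambda>x. sqrt (\<chi>\<omega> x) *\<^sub>R v x)"

definition energy_inequality_from ::
  "real \<Rightarrow> (real^3 \<Rightarrow> real) \<Rightarrow> (real \<Rightarrow> real) \<Rightarrow> (real \<Rightarrow> real^3 \<Rightarrow> real^3) \<Rightarrow> real \<Rightarrow> bool" where
  "energy_inequality_from \<nu> \<chi>\<omega> \<kappa> u s \<longleftrightarrow>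
     (\<forall>t\<ge>s. 1/2 * (L2_norm (u t))\<^sup>2
            + \<nu> * (LINT \<tau>|lebesgue_on {s..t}. (L2_norm (weak_grad (u \<tau>)))\<^sup>2)
            + (LINT \<tau>|lebesgue_on {s..t}. \<kappa> \<tau> * (damping_norm \<chi>\<omega> (u \<tau>))\<^sup>2)
          \<le> 1/2 * (L2_norm (u s))\<^sup>2)"

definition leray_hopf_solution ::
  "real \<Rightarrow> (real^3 \<Rightarrow> real) \<Rightarrow> (real \<Rightarrow> real) \<Rightarrow> (real^3 \<Rightarrow> real^3) \<Rightarrow>
   (real \<Rightarrow> real^3 \<Rightarrow> real^3) \<Rightarrow> bool" where
  "leray_hopf_solution \<nu> \<chi>\<omega> \<kappa> u0 u \<longleftrightarrow>
     Linf_H u \<and> L2loc_V u \<and> weakly_continuous_H u \<and>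
     (AE x in torus. u 0 x = u0 x) \<and>
     weak_form \<nu> \<chi>\<omega> \<kappa> u0 u \<and>
     energy_inequality_from \<nu> \<chi>\<omega> \<kappa> u 0 \<and>
     (AE s in lebesgue_on {0..}. energy_inequality_from \<nu> \<chi>\<omega> \<kappa> u s)"

definition alpha :: "real \<Rightarrow> (real^3 \<Rightarrow> real) \<Rightarrow> real \<Rightarrow> real" where
  "alpha \<nu> \<chi>\<omega> Kmin =
     (INF v\<in>{v \<in> V_space. \<not> (AE x in torus. v x = 0)}.
        (\<nu> * (L2_norm (weak_grad v))\<^sup>2 + Kmin * (damping_norm \<chi>\<omega> v)\<^sup>2) / (L2_norm v)\<^sup>2)"

end

theory Submission
  imports Defs
begin

text \<open>
  By the definition of \<open>\<alpha>\<close> the dissipation dominates \<open>\<alpha> \<parallel>u\<parallel>\<^sup>2\<close>, so \<open>y = \<parallel>u\<parallel>\<^sup>2\<close> satisfies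
  \<open>y t + 2 \<alpha> \<integral>\<^sub>s\<^sup>t y \<le> y s\<close> for \<open>s = 0\<close> and almost every \<open>s\<close>. As y need not be continuous, Gronwall's
  lemma is applied backwards in \<open>s\<close>, at fixed \<open>t\<close>, to the continuous minorant
  \<open>w s = y t + 2 \<alpha> \<integral>\<^sub>s\<^sup>t y\<close> of y.
  Since a Bochner integral of a non-integrable function is 0, the dissipation terms must be shown
  to be integrable; their measurability comes from strong measurability of u.
\<close>

section \<open>A backward Gronwall lemma\<close>

text \<open>The bound ends at \<open>y t + c * integral {0..t} y\<close> and not at
  \<open>y 0\<close>, since the point 0 may lie in the exceptional set \<open>N\<close>.\<close>

lemma backward_gronwall_ae:
  fixes y :: "real \<Rightarrow> real"
  assumes t: "0 \<le> t" and c: "0 < c"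
    and int: "y integrable_on {0..t}"
    and N: "negligible N"
    and ineq: "\<And>s. s \<in> {0..t} - N \<Longrightarrow> y t + c * integral {s..t} y \<le> y s"
  shows "exp (c * t) * y t \<le> y t + c * integral {0..t} y"
proof -
  define w where "w s = y t + c * integral {s..t} y" for s
  have cw: "continuous_on {0..t} w"
    unfolding w_def by (intro continuous_intros indefinite_integral_continuous_1' int)
  \<comment> \<open>As \<open>y\<close> is only integrable, \<open>w\<close> is continuous but need
    not be differentiable everywhere. Its integral \<open>W\<close> is continuously differentiable,
    so the monotonicity argument is run on \<open>W\<close>.\<close>
  define W where "W s = integral {s..t} w" for s
  have W_le: "W s \<le> integral {s..t} y" if "s \<in> {0..t}" for s
    unfolding W_def
  proof -
    have yi: "y integrable_on {s..t}"
      using that by (intro integrable_subinterval_real[OF int]) auto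
    have wi: "w integrable_on {s..t}"
      using that by (intro integrable_continuous_interval continuous_on_subset[OF cw]) auto
    \<comment> \<open>Overwriting \<open>y\<close> by \<open>w\<close> on the null set
      \<open>N\<close> makes the comparison hold at every point and leaves the integral
      unchanged.\<close>
    let ?y = "\<lambda>\<tau>. if \<tau> \<in> N then w \<tau> else y \<tau>"
    have "integral {s..t} w \<le> integral {s..t} ?y"
      using that ineq by (intro integral_le wi integrable_spike[OF yi N]) (auto simp: w_def)
    also have "\<dots> = integral {s..t} y"
      by (rule integral_spike[OF N]) auto
    finally show "integral {s..t} w \<le> integral {s..t} y" .
  qed
  have dW: "(W has_real_derivative - w s) (at s within {0..t})" if "s \<in> {0..t}" for s
    unfolding W_def by (rule integral_has_real_derivative'[OF cw that])
  \<comment> \<open>Integrating factor for the differential inequality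
    \<open>c * W s + y t \<le> w s = - W' s\<close>, which makes \<open>F\<close> nonincreasing. At
    \<open>s = t\<close> the integral \<open>W\<close> vanishes.\<close>
  define F where "F s = exp (c * s) * (c * W s + y t)" for s
  have dF: "(F has_real_derivative c * exp (c * s) * (c * W s + y t - w s)) (at s within {0..t})"
    if "s \<in> {0..t}" for s
    unfolding F_def
    by (rule derivative_eq_intros dW[OF that] refl)+ (simp add: algebra_simps)
  have "F t \<le> F 0"
  proof (rule DERIV_nonpos_imp_decreasing_open[OF t])
    fix s assume s: "0 < s" "s < t"
    then have "c * W s + y t \<le> w s"
      using W_le[of s] c by (simp add: w_def)
    then have "c * exp (c * s) * (c * W s + y t - w s) \<le> 0"
      using c by (intro mult_nonneg_nonpos) auto
    moreover have "(F has_real_derivative c * exp (c * s) * (c * W s + y t - w s)) (at s)"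
      using dF[of s] s by (simp add: at_within_Icc_at)
    ultimately show "\<exists>z. DERIV F s :> z \<and> z \<le> 0" by blast
  next
    show "continuous_on {0..t} F"
      using dF by (rule DERIV_continuous_on)
  qed
  moreover have "F t = exp (c * t) * y t"
    by (simp add: F_def W_def)
  moreover have "F 0 \<le> y t + c * integral {0..t} y"
    using W_le[of 0] t c by (simp add: F_def)
  ultimately show ?thesis by linarith
qed

section \<open>The \<open>L\<^sup>2\<close> norm\<close>

text \<open>The defect is a perfect square that vanishes when \<open>norm a\<close> and
  \<open>norm b\<close> are in the ratio \<open>p\<close> to \<open>q\<close>. With constant weights
  the right-hand side is linear in the two squares, so integrating it gives the triangle inequality
  in \<open>L2_norm\<close> without Cauchy-Schwarz.\<close>

lemma norm_add_square_le:
  fixes a b :: "'a::real_inner"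
  assumes "0 < p" "0 < q"
  shows "(norm (a + b))\<^sup>2 \<le> (p + q) * ((norm a)\<^sup>2 / p + (norm b)\<^sup>2 / q)"
proof -
  have "(norm (a + b))\<^sup>2 \<le> (norm a + norm b)\<^sup>2"
    by (intro power_mono norm_triangle_ineq) auto
  also have "\<dots> \<le> (p + q) * ((norm a)\<^sup>2 / p + (norm b)\<^sup>2 / q)"
  proof -
    have "(p + q) * ((norm a)\<^sup>2 / p + (norm b)\<^sup>2 / q) - (norm a + norm b)\<^sup>2
        = (q * norm a - p * norm b)\<^sup>2 / (p * q)"
      using assms by (simp add: field_simps power2_eq_square)
    also have "\<dots> \<ge> 0" using assms by simp
    finally show ?thesis by simp
  qed
  finally show ?thesis .
qed

lemma L2_norm_nonneg: "0 \<le> L2_norm f"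
  by (simp add: L2_norm_def)

lemma L2_norm_power2: "(L2_norm f)\<^sup>2 = (LINT x|torus. (norm (f x))\<^sup>2)"
  by (simp add: L2_norm_def)

lemma L2_torus_add:
  fixes f g :: "real^3 \<Rightarrow> 'b::euclidean_space"
  assumes "f \<in> L2_torus" "g \<in> L2_torus"
  shows "(\<lambda>x. f x + g x) \<in> L2_torus"
proof -
  have [measurable]: "f \<in> borel_measurable torus" "g \<in> borel_measurable torus"
    and int: "integrable torus (\<lambda>x. (norm (f x))\<^sup>2)" "integrable torus (\<lambda>x. (norm (g x))\<^sup>2)"
    using assms by (auto simp: L2_torus_def)
  have "integrable torus (\<lambda>x. (norm (f x + g x))\<^sup>2)"
  proof (rule Bochner_Integration.integrable_bound)
    \<comment> \<open>The dominating function is the right-hand side of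
      \<open>norm_add_square_le\<close> with both weights equal to 1.\<close>
    show "integrable torus (\<lambda>x. (1 + 1) * ((norm (f x))\<^sup>2 / 1 + (norm (g x))\<^sup>2 / 1))"
      using int by (intro integrable_mult_right integrable_add integrable_divide) auto
    show "AE x in torus. norm ((norm (f x + g x))\<^sup>2)
        \<le> norm ((1 + 1) * ((norm (f x))\<^sup>2 / 1 + (norm (g x))\<^sup>2 / 1))"
      using norm_add_square_le[of 1 1 "f _" "g _"] by (intro AE_I2) auto
  qed measurable
  then show ?thesis
    using assms by (auto simp: L2_torus_def periodic_def)
qed

lemma L2_torus_diff:
  fixes f g :: "real^3 \<Rightarrow> 'b::euclidean_space"
  assumes "f \<in> L2_torus" "g \<in> L2_torus"
  shows "(\<lambda>x. f x - g x) \<in> L2_torus"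
proof -
  have "(\<lambda>x. - g x) \<in> L2_torus"
    using assms(2) by (auto simp: L2_torus_def periodic_def)
  from L2_torus_add[OF assms(1) this] show ?thesis by simp
qed

lemma L2_norm_triangle:
  fixes f g :: "real^3 \<Rightarrow> 'b::euclidean_space"
  assumes "f \<in> L2_torus" "g \<in> L2_torus"
  shows "L2_norm (\<lambda>x. f x + g x) \<le> L2_norm f + L2_norm g"
proof (rule field_le_epsilon)
  \<comment> \<open>The weights p and q exceed the norms strictly, so neither is zero.\<close>
  fix e :: real assume e: "0 < e"
  define p q where "p = L2_norm f + e/2" and "q = L2_norm g + e/2"
  have pq: "0 < p" "0 < q" "L2_norm f \<le> p" "L2_norm g \<le> q"
    using e L2_norm_nonneg[of f] L2_norm_nonneg[of g] by (auto simp: p_def q_def)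
  have int: "integrable torus (\<lambda>x. (norm (f x))\<^sup>2)" "integrable torus (\<lambda>x. (norm (g x))\<^sup>2)"
    using assms by (auto simp: L2_torus_def)
  have "(L2_norm (\<lambda>x. f x + g x))\<^sup>2
      \<le> (LINT x|torus. (p + q) * ((norm (f x))\<^sup>2 / p + (norm (g x))\<^sup>2 / q))"
    unfolding L2_norm_power2
    using L2_torus_add[OF assms] int pq
    by (intro integral_mono norm_add_square_le integrable_mult_right integrable_add
        integrable_divide) (auto simp: L2_torus_def)
  also have "\<dots> = (p + q) * ((L2_norm f)\<^sup>2 / p + (L2_norm g)\<^sup>2 / q)"
    using int by (simp add: L2_norm_power2)
  \<comment> \<open>Enlarging the norms to \<open>p\<close> and \<open>q\<close> reduces the two
    quotients to \<open>p\<close> and \<open>q\<close>, which leaves a perfect square.\<close>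
  also have "\<dots> \<le> (p + q) * (p\<^sup>2 / p + q\<^sup>2 / q)"
    using pq L2_norm_nonneg[of f] L2_norm_nonneg[of g]
    by (intro mult_left_mono add_mono divide_right_mono power_mono) auto
  also have "\<dots> = (p + q)\<^sup>2"
    using pq by (simp add: power2_eq_square)
  finally have "L2_norm (\<lambda>x. f x + g x) \<le> p + q"
    by (rule power2_le_imp_le) (use pq in simp)
  then show "L2_norm (\<lambda>x. f x + g x) \<le> L2_norm f + L2_norm g + e"
    by (simp add: p_def q_def)
qed

lemma L2_norm_diff_bound:
  fixes f g :: "real^3 \<Rightarrow> 'b::euclidean_space"
  assumes "f \<in> L2_torus" "g \<in> L2_torus"
  shows "\<bar>L2_norm f - L2_norm g\<bar> \<le> L2_norm (\<lambda>x. f x - g x)"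
proof -
  have "L2_norm (\<lambda>x. g x - f x) = L2_norm (\<lambda>x. f x - g x)"
    by (simp add: L2_norm_def norm_minus_commute)
  then show ?thesis
    using L2_norm_triangle[OF L2_torus_diff[OF assms] assms(2)]
      L2_norm_triangle[OF L2_torus_diff[OF assms(2,1)] assms(1)] by simp
qed

lemma damping_field_L2:
  fixes v :: "real^3 \<Rightarrow> real^3"
  assumes \<chi>\<omega>: "\<chi>\<omega> \<in> Linf_torus" and C: "AE x in torus. \<bar>\<chi>\<omega> x\<bar> \<le> C" and v: "v \<in> L2_torus"
  shows "(\<lambda>x. sqrt (\<chi>\<omega> x) *\<^sub>R v x) \<in> L2_torus"
    and "(damping_norm \<chi>\<omega> v)\<^sup>2 \<le> C * (L2_norm v)\<^sup>2"
proof -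
  have [measurable]: "\<chi>\<omega> \<in> borel_measurable torus" "v \<in> borel_measurable torus"
    and int: "integrable torus (\<lambda>x. (norm (v x))\<^sup>2)"
    using assms by (auto simp: L2_torus_def Linf_torus_def)
  \<comment> \<open>\<open>sqrt\<close> is an odd function on the whole real line, so squaring
    \<open>sqrt (\<chi>\<omega> x)\<close> produces an absolute value.\<close>
  have eq: "(norm (sqrt (\<chi>\<omega> x) *\<^sub>R v x))\<^sup>2 = \<bar>\<chi>\<omega> x\<bar> * (norm (v x))\<^sup>2" for x
    by (simp add: power_mult_distrib) (metis real_sqrt_abs real_sqrt_power)
  have le: "AE x in torus. (norm (sqrt (\<chi>\<omega> x) *\<^sub>R v x))\<^sup>2 \<le> C * (norm (v x))\<^sup>2"
    using C unfolding eq by eventually_elim (intro mult_right_mono; simp)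
  have intC: "integrable torus (\<lambda>x. C * (norm (v x))\<^sup>2)"
    using int by simp
  have int2: "integrable torus (\<lambda>x. (norm (sqrt (\<chi>\<omega> x) *\<^sub>R v x))\<^sup>2)"
  proof (rule Bochner_Integration.integrable_bound[OF intC])
    show "AE x in torus. norm ((norm (sqrt (\<chi>\<omega> x) *\<^sub>R v x))\<^sup>2) \<le> norm (C * (norm (v x))\<^sup>2)"
      using le by eventually_elim auto
  qed measurable
  then show "(\<lambda>x. sqrt (\<chi>\<omega> x) *\<^sub>R v x) \<in> L2_torus"
    using assms by (auto simp: L2_torus_def Linf_torus_def periodic_def)
  have "(damping_norm \<chi>\<omega> v)\<^sup>2 \<le> (LINT x|torus. C * (norm (v x))\<^sup>2)"
    unfolding damping_norm_def L2_norm_power2 by (rule integral_mono_AE[OF int2 intC le])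
  then show "(damping_norm \<chi>\<omega> v)\<^sup>2 \<le> C * (L2_norm v)\<^sup>2"
    by (simp add: L2_norm_power2)
qed

text \<open>The reverse triangle inequality for the weighted fields, combined with the bound on the
  weight. This is the Lipschitz property that \<open>strongly_measurable_functional\<close> asks
  for.\<close>

lemma damping_norm_diff_bound:
  fixes v w :: "real^3 \<Rightarrow> real^3"
  assumes \<chi>\<omega>: "\<chi>\<omega> \<in> Linf_torus" and C: "AE x in torus. \<bar>\<chi>\<omega> x\<bar> \<le> C"
    and v: "v \<in> L2_torus" and w: "w \<in> L2_torus"
  shows "\<bar>damping_norm \<chi>\<omega> v - damping_norm \<chi>\<omega> w\<bar> \<le> sqrt C * L2_norm (\<lambda>x. v x - w x)"
proof -
  have "\<bar>damping_norm \<chi>\<omega> v - damping_norm \<chi>\<omega> w\<bar> \<le> damping_norm \<chi>\<omega> (\<lambda>x. v x - w x)"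
    using L2_norm_diff_bound[OF damping_field_L2(1)[OF \<chi>\<omega> C v] damping_field_L2(1)[OF \<chi>\<omega> C w]]
    by (simp add: damping_norm_def scaleR_diff_right)
  also have "\<dots> \<le> sqrt C * L2_norm (\<lambda>x. v x - w x)"
  proof -
    have "sqrt ((damping_norm \<chi>\<omega> (\<lambda>x. v x - w x))\<^sup>2) \<le> sqrt (C * (L2_norm (\<lambda>x. v x - w x))\<^sup>2)"
      by (intro real_sqrt_le_mono damping_field_L2(2)[OF \<chi>\<omega> C L2_torus_diff[OF v w]])
    then show ?thesis
      by (simp add: real_sqrt_mult L2_norm_nonneg damping_norm_def)
  qed
  finally show ?thesis .
qed

section \<open>Measurability in time\<close>

text \<open>Extension by zero moves the question to \<open>lebesgue\<close>, whose completeness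
  allows a measurable function to be changed on a null set.\<close>

lemma borel_measurable_lebesgue_on_AE_LIMSEQ:
  fixes f :: "nat \<Rightarrow> 'a::euclidean_space \<Rightarrow> real"
  assumes S: "S \<in> sets lebesgue"
    and f: "\<And>n. f n \<in> borel_measurable (lebesgue_on S)"
    and lim: "AE x in lebesgue_on S. (\<lambda>n. f n x) \<longlonglongrightarrow> g x"
  shows "g \<in> borel_measurable (lebesgue_on S)"
proof -
  define h where "h n = (\<lambda>x. if x \<in> S then f n x else 0)" for n
  have h: "h n \<in> borel_measurable lebesgue" for n
    using f[of n] S by (simp add: h_def borel_measurable_if)
  have "AE x in lebesgue. x \<in> S \<longrightarrow> (\<lambda>n. f n x) \<longlonglongrightarrow> g x"
    using lim S by (simp add: AE_restrict_space_iff)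
  then have "AE x in lebesgue. lim (\<lambda>n. h n x) = (if x \<in> S then g x else 0)"
    by eventually_elim (auto simp: h_def limI)
  from borel_measurable_AE[OF borel_measurable_lim_metric this] h
  have "(\<lambda>x. if x \<in> S then g x else 0) \<in> borel_measurable lebesgue" by blast
  then show ?thesis
    using S by (simp add: borel_measurable_if)
qed

text \<open>A simple function has finitely many values, so its composition with any functional is
  again simple. Convergence in \<open>N\<close> forces convergence in \<open>L2_norm\<close>, and
  the Lipschitz bound carries it over to the values of \<open>\<Phi>\<close>.\<close>

lemma strongly_measurable_functional:
  fixes u :: "real \<Rightarrow> real^3 \<Rightarrow> real^3" and \<Phi> :: "(real^3 \<Rightarrow> real^3) \<Rightarrow> real"
  assumes S: "S \<in> sets lebesgue"
    and sm: "strongly_measurable (lebesgue_on S) X N u"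
    and X: "X \<subseteq> L2_torus" and u: "AE t in lebesgue_on S. u t \<in> L2_torus"
    and N: "\<And>v. L2_norm v \<le> N v"
    and \<Phi>: "\<And>v w. v \<in> L2_torus \<Longrightarrow> w \<in> L2_torus \<Longrightarrow>
        \<bar>\<Phi> v - \<Phi> w\<bar> \<le> L * L2_norm (\<lambda>x. v x - w x)"
  shows "(\<lambda>t. \<Phi> (u t)) \<in> borel_measurable (lebesgue_on S)"
proof -
  obtain s where s: "\<And>n. simple_function (lebesgue_on S) (s n)"
      "\<And>n. s n ` space (lebesgue_on S) \<subseteq> X"
    and lim: "AE t in lebesgue_on S. (\<lambda>n. N (\<lambda>x. s n t x - u t x)) \<longlonglongrightarrow> 0"
    using sm unfolding strongly_measurable_def by blast
  show ?thesis
  proof (rule borel_measurable_lebesgue_on_AE_LIMSEQ[OF S])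
    show "(\<lambda>t. \<Phi> (s n t)) \<in> borel_measurable (lebesgue_on S)" for n
      by (intro borel_measurable_simple_function simple_function_compose1[OF s(1)])
    show "AE t in lebesgue_on S. (\<lambda>n. \<Phi> (s n t)) \<longlonglongrightarrow> \<Phi> (u t)"
      using lim u AE_space
    proof eventually_elim
      case (elim t)
      have L2: "(\<lambda>n. L2_norm (\<lambda>x. s n t x - u t x)) \<longlonglongrightarrow> 0"
        by (rule tendsto_sandwich[OF _ _ tendsto_const elim(1)])
          (auto simp: L2_norm_nonneg N)
      have "s n t \<in> L2_torus" for n
        using s(2)[of n] elim(3) X by auto
      then have "\<bar>\<Phi> (s n t) - \<Phi> (u t)\<bar> \<le> L * L2_norm (\<lambda>x. s n t x - u t x)" for n
        using \<Phi> elim(2) by blast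
      moreover have "(\<lambda>n. L * L2_norm (\<lambda>x. s n t x - u t x)) \<longlonglongrightarrow> 0"
        using tendsto_mult_right_zero[OF L2] by simp
      ultimately have "(\<lambda>n. \<Phi> (s n t) - \<Phi> (u t)) \<longlonglongrightarrow> 0"
        by (intro Lim_null_comparison[where f="\<lambda>n. \<Phi> (s n t) - \<Phi> (u t)"]) auto
      then show ?case by (simp add: LIM_zero_iff)
    qed
  qed
qed

section \<open>Decay of the energy\<close>

lemma V_norm_ge_L2_norm: "L2_norm v \<le> V_norm v"
  by (simp add: V_norm_def L2_norm_nonneg real_le_rsqrt)

text \<open>The quotients are bounded below by 0, so the real infimum is a genuine lower bound for
  them. Fields of zero norm lie outside the infimum, but for them the left-hand side
  vanishes.\<close>

lemma alpha_coercive: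
  assumes "\<nu> > 0" "Kmin \<ge> 0" and v: "v \<in> V_space"
  shows "alpha \<nu> \<chi>\<omega> Kmin * (L2_norm v)\<^sup>2
    \<le> \<nu> * (L2_norm (weak_grad v))\<^sup>2 + Kmin * (damping_norm \<chi>\<omega> v)\<^sup>2"
proof (cases "L2_norm v = 0")
  case True
  then show ?thesis using assms by simp
next
  case False
  have nz: "\<not> (AE x in torus. v x = 0)"
  proof
    assume "AE x in torus. v x = 0"
    then have "AE x in torus. (norm (v x))\<^sup>2 = 0"
      by eventually_elim simp
    then have "(L2_norm v)\<^sup>2 = 0"
      unfolding L2_norm_power2 by (rule integral_eq_zero_AE)
    with False show False by simp
  qed
  have "alpha \<nu> \<chi>\<omega> Kmin
      \<le> (\<nu> * (L2_norm (weak_grad v))\<^sup>2 + Kmin * (damping_norm \<chi>\<omega> v)\<^sup>2) / (L2_norm v)\<^sup>2"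
    unfolding alpha_def
    by (rule cINF_lower) (use v nz assms in \<open>auto intro!: bdd_belowI2[where m=0]\<close>)
  then show ?thesis
    using False by (simp add: field_simps)
qed

theorem theorem2p6:
  fixes \<nu> Kmin :: real
    and \<chi>\<omega> :: "real^3 \<Rightarrow> real"
    and K :: "'r \<Rightarrow> real" and \<rho> :: "real \<Rightarrow> 'r"
    and u0 :: "real^3 \<Rightarrow> real^3"
    and u :: "real \<Rightarrow> real^3 \<Rightarrow> real^3"
  assumes "\<nu> > 0"
    and "\<chi>\<omega> \<in> Linf_torus" and "AE x in torus. \<chi>\<omega> x \<ge> 0"
    and "(\<lambda>t. K (\<rho> t)) \<in> borel_measurable (lebesgue_on {0..})"
    and "bounded ((\<lambda>t. K (\<rho> t)) ` {0..})"
    and "\<forall>t\<ge>0. K (\<rho> t) \<ge> 0"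
    and "Kmin \<ge> 0"
    and "u0 \<in> H_space"
    and "alpha \<nu> \<chi>\<omega> Kmin > 0"
    and "AE t in lebesgue_on {0..}. K (\<rho> t) \<ge> Kmin"
    and "leray_hopf_solution \<nu> \<chi>\<omega> (\<lambda>t. K (\<rho> t)) u0 u"
  shows "\<forall>t\<ge>0. L2_norm (u t) \<le> exp (- alpha \<nu> \<chi>\<omega> Kmin * t) * L2_norm u0"
proof (intro allI impI)
  fix t :: real assume t0: "t \<ge> 0"
  define \<alpha> where "\<alpha> = alpha \<nu> \<chi>\<omega> Kmin"
  have \<alpha>: "\<alpha> > 0" using assms(9) by (simp add: \<alpha>_def)
  define \<kappa> where "\<kappa> = (\<lambda>\<tau>. K (\<rho> \<tau>))"
  define y where "y = (\<lambda>\<tau>. (L2_norm (u \<tau>))\<^sup>2)"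
  define g where "g = (\<lambda>\<tau>. (L2_norm (weak_grad (u \<tau>)))\<^sup>2)"
  define d where "d = (\<lambda>\<tau>. \<kappa> \<tau> * (damping_norm \<chi>\<omega> (u \<tau>))\<^sup>2)"
  note LH = assms(11)[unfolded leray_hopf_solution_def]
  have u0_eq: "L2_norm (u 0) = L2_norm u0"
  proof -
    have "u 0 \<in> L2_torus" "u0 \<in> L2_torus"
      using LH assms(8) by (auto simp: weakly_continuous_H_def H_space_def)
    then have [measurable]: "u 0 \<in> borel_measurable torus" "u0 \<in> borel_measurable torus"
      by (auto simp: L2_torus_def)
    have "AE x in torus. u 0 x = u0 x" using LH by blast
    then have "(LINT x|torus. (norm (u 0 x))\<^sup>2) = (LINT x|torus. (norm (u0 x))\<^sup>2)"
      by (intro integral_cong_AE) auto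
    then show ?thesis by (simp add: L2_norm_def)
  qed
  have restrict_AE: "AE \<tau> in lebesgue_on {0..t}. P \<tau>" if "AE \<tau> in lebesgue_on {0..}. P \<tau>"
    for P :: "real \<Rightarrow> bool"
    using that by (auto simp: AE_restrict_space_iff elim: eventually_mono)
  \<comment> \<open>\<open>L2loc_V\<close> speaks of intervals \<open>{0..T}\<close> with
    \<open>T > 0\<close> only, hence the restriction to positive \<open>t\<close>.\<close>
  have energy: "y t + 2 * \<alpha> * integral {s..t} y \<le> y s" and y_int: "y integrable_on {0..t}"
    if t: "0 < t" and s: "s \<in> {0..t}" and E: "energy_inequality_from \<nu> \<chi>\<omega> \<kappa> u s" for s
  proof -
    let ?M = "lebesgue_on {0..t}"
    have sm: "strongly_measurable ?M V_space V_norm u"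
      and uV: "AE \<tau> in ?M. u \<tau> \<in> V_space"
      and V_int: "integrable ?M (\<lambda>\<tau>. (V_norm (u \<tau>))\<^sup>2)"
      using LH t by (auto simp: L2loc_V_def)
    have V_L2: "V_space \<subseteq> L2_torus" by (auto simp: V_space_def H_space_def)
    have uL2: "AE \<tau> in ?M. u \<tau> \<in> L2_torus"
      using uV by eventually_elim (use V_L2 in auto)
    obtain C0 where C0: "AE x in torus. \<bar>\<chi>\<omega> x\<bar> \<le> C0"
      using assms(2) by (auto simp: Linf_torus_def)
    define C where "C = max C0 0"
    have C: "AE x in torus. \<bar>\<chi>\<omega> x\<bar> \<le> C"
      using C0 by eventually_elim (auto simp: C_def)
    obtain B where B: "\<And>\<tau>. 0 \<le> \<tau> \<Longrightarrow> \<kappa> \<tau> \<le> B"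
      using assms(5) by (auto simp: bounded_iff \<kappa>_def intro: order_trans[OF abs_ge_self])
    have [measurable]: "(\<lambda>\<tau>. L2_norm (u \<tau>)) \<in> borel_measurable ?M"
      by (rule strongly_measurable_functional[OF _ sm V_L2 uL2 V_norm_ge_L2_norm, where L=1])
        (auto intro: L2_norm_diff_bound)
    have [measurable]: "(\<lambda>\<tau>. damping_norm \<chi>\<omega> (u \<tau>)) \<in> borel_measurable ?M"
      by (rule strongly_measurable_functional[OF _ sm V_L2 uL2 V_norm_ge_L2_norm])
        (auto intro: damping_norm_diff_bound[OF assms(2) C])
    have [measurable]: "\<kappa> \<in> borel_measurable ?M"
      unfolding \<kappa>_def by (rule measurable_restrict_mono[OF assms(4)]) auto
    have y_L: "integrable ?M y"
    proof (rule Bochner_Integration.integrable_bound[OF V_int])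
      show "y \<in> borel_measurable ?M" unfolding y_def by measurable
      show "AE \<tau> in ?M. norm (y \<tau>) \<le> norm ((V_norm (u \<tau>))\<^sup>2)"
        by (intro AE_I2) (simp add: y_def V_norm_ge_L2_norm L2_norm_nonneg power_mono)
    qed
    have g_L: "integrable ?M g"
    proof -
      \<comment> \<open>The gradient norm is not Lipschitz in \<open>L2_norm\<close>, so its square
        is obtained as the difference of two functions already known to be integrable.\<close>
      have "integrable ?M (\<lambda>\<tau>. (V_norm (u \<tau>))\<^sup>2 - y \<tau>)"
        using V_int y_L by simp
      then show ?thesis by (simp add: V_norm_def y_def g_def)
    qed
    have d_L: "integrable ?M d"
    proof (rule Bochner_Integration.integrable_bound)
      show "integrable ?M (\<lambda>\<tau>. B * C * y \<tau>)" using y_L by simp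
      show "d \<in> borel_measurable ?M" unfolding d_def by measurable
      show "AE \<tau> in ?M. norm (d \<tau>) \<le> norm (B * C * y \<tau>)"
        using uL2 AE_space
      proof eventually_elim
        case (elim \<tau>)
        then have "0 \<le> \<kappa> \<tau>" "\<kappa> \<tau> \<le> B"
          using assms(6) B by (auto simp: \<kappa>_def)
        moreover have "(damping_norm \<chi>\<omega> (u \<tau>))\<^sup>2 \<le> C * y \<tau>"
          unfolding y_def by (rule damping_field_L2(2)[OF assms(2) C elim(1)])
        ultimately have "d \<tau> \<le> B * (C * y \<tau>)" "0 \<le> d \<tau>"
          unfolding d_def by (auto intro!: mult_mono)
        then show ?case by (simp add: mult.assoc)
      qed
    qed
    show "y integrable_on {0..t}"
      using y_L by (simp add: integrable_on_lebesgue_on)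
    have int: "integrable (lebesgue_on {s..t}) y" "integrable (lebesgue_on {s..t}) g"
        "integrable (lebesgue_on {s..t}) d"
      using s by (auto intro!: integrable_subinterval[OF y_L] integrable_subinterval[OF g_L]
          integrable_subinterval[OF d_L])
    \<comment> \<open>Coercivity at almost every time, with \<open>Kmin\<close> replaced by the
      larger actual gain \<open>\<kappa> \<tau>\<close>.\<close>
    have "AE \<tau> in ?M. \<alpha> * y \<tau> \<le> \<nu> * g \<tau> + d \<tau>"
      using uV restrict_AE[OF assms(10)]
    proof eventually_elim
      case (elim \<tau>)
      then have "Kmin * (damping_norm \<chi>\<omega> (u \<tau>))\<^sup>2 \<le> d \<tau>"
        unfolding d_def \<kappa>_def by (intro mult_right_mono) auto
      then show ?case
        using alpha_coercive[OF assms(1,7) elim(1), of \<chi>\<omega>]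
        unfolding \<alpha>_def y_def g_def by linarith
    qed
    then have "AE \<tau> in lebesgue_on {s..t}. \<alpha> * y \<tau> \<le> \<nu> * g \<tau> + d \<tau>"
      using s by (auto simp: AE_restrict_space_iff elim: eventually_mono)
    then have "(LINT \<tau>|lebesgue_on {s..t}. \<alpha> * y \<tau>)
        \<le> (LINT \<tau>|lebesgue_on {s..t}. \<nu> * g \<tau> + d \<tau>)"
      using int by (intro integral_mono_AE) auto
    then have "\<alpha> * integral {s..t} y \<le> \<nu> * integral\<^sup>L (lebesgue_on {s..t}) g
        + integral\<^sup>L (lebesgue_on {s..t}) d"
      using int by (simp add: lebesgue_integral_eq_integral)
    moreover have "1/2 * y t + \<nu> * integral\<^sup>L (lebesgue_on {s..t}) g
        + integral\<^sup>L (lebesgue_on {s..t}) d \<le> 1/2 * y s"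
      using E s by (simp add: energy_inequality_from_def y_def g_def d_def)
    \<comment> \<open>Clearing the factors 1/2 of the energy doubles the rate to
      \<open>2 * \<alpha>\<close>; the final square root halves it again.\<close>
    ultimately show "y t + 2 * \<alpha> * integral {s..t} y \<le> y s" by linarith
  qed
  have E0: "energy_inequality_from \<nu> \<chi>\<omega> \<kappa> u 0"
    and E: "AE s in lebesgue_on {0..}. energy_inequality_from \<nu> \<chi>\<omega> \<kappa> u s"
    using LH by (auto simp: \<kappa>_def)
  show "L2_norm (u t) \<le> exp (- alpha \<nu> \<chi>\<omega> Kmin * t) * L2_norm u0"
  proof (cases "t = 0")
    case True
    then show ?thesis by (simp add: u0_eq)
  next
    case False
    with t0 have t: "0 < t" by simp
    have "AE s in lebesgue. s \<in> {0..t} \<longrightarrow> energy_inequality_from \<nu> \<chi>\<omega> \<kappa> u s"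
      using restrict_AE[OF E] by (simp add: AE_restrict_space_iff)
    then obtain N where N: "negligible N"
      "\<And>s. s \<in> {0..t} - N \<Longrightarrow> energy_inequality_from \<nu> \<chi>\<omega> \<kappa> u s"
      unfolding eventually_ae_filter_negligible by blast
    \<comment> \<open>Gronwall uses the energy inequality from almost every \<open>s\<close>; the
      separate inequality from time 0 then bounds its right-hand side by the initial energy.\<close>
    have "exp (2 * \<alpha> * t) * y t \<le> y t + 2 * \<alpha> * integral {0..t} y"
      using t \<alpha> by (intro backward_gronwall_ae[OF _ _ _ N(1)] energy y_int[OF t _ E0] N(2)) auto
    also have "\<dots> \<le> y 0"
      using energy[OF t _ E0] t by simp
    finally have "exp (2 * \<alpha> * t) * y t \<le> (L2_norm u0)\<^sup>2"
      by (simp add: y_def u0_eq)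
    moreover have "(exp (\<alpha> * t) * L2_norm (u t))\<^sup>2 = exp (2 * \<alpha> * t) * y t"
      by (simp add: y_def power_mult_distrib power2_eq_square flip: exp_add)
    ultimately have "(exp (\<alpha> * t) * L2_norm (u t))\<^sup>2 \<le> (L2_norm u0)\<^sup>2" by simp
    then have "exp (\<alpha> * t) * L2_norm (u t) \<le> L2_norm u0"
      by (rule power2_le_imp_le) (rule L2_norm_nonneg)
    from mult_left_mono[OF this, of "exp (- \<alpha> * t)"] show ?thesis
      by (simp add: \<alpha>_def mult.assoc[symmetric] flip: exp_add)
  qed
qed

end
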